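(* Let $G$ be an electrical network and let $A,B$ be disjoint nonempty sets of vertices. For any collection $\{S_i\}_{i\in I}$ of (not necessarily disjoint) cutsets between $A$ and $B$ and any resistance allocation $(R_{e,i})$ for it, \[ \operatorname{Res}(A,B)\ \ge\ \sum_{i\in I} C(S_i)^{-1}. \] Moreover, if the graph $G$ is finite, then $\operatorname{Res}(A,B)$ is the supremum of $\sum_i C(S_i)^{-1}$ over all collections of cutsets between $A$ and $B$ and all resistance allocations on them.
   Context: An electrical network is a graph $G=(V,E)$ with edge conductances $C_e>0$; the resistance of $e$ is $R_e=C_e^{-1}$. $\operatorname{Res}(A,B)$ is the effective resistance between $A$ and $B$, i.e. $\operatorname{Res}(A,B)^{-1}=\inf\{\sum_{e=\{x,y\}}C_e(f(x)-f(y))^2 : f:V\to\mathbb R,\ f|_A=0,\ f|_B=1\}$. A cutset between $A$ and $B$ is a set of edges $S$ that separates $A$ from $B$ (every path from $A$ to $B$ uses an edge of $S$). Given a collection $\{S_i\}_{i\in I}$ of cutsets, a resistance allocation is a choice of numbers $R_{e,i}\ge0$ for $e\in E$, $i\in I$ such that $\sum_iR_{e,i}\le R_e$ for every edge $e$, and $R_{e,i}=0$ if $e\notin S_i$. The split conductance of $S_i$ is $C(S_i)=\sum_{e\in S_i}R_{e,i}^{-1}$. The conventions $1/0=\infty$ and $1/\infty=0$ are used. *)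

theory Defs
  imports "HOL-Analysis.Analysis"
begin

text \<open>Edges are unordered pairs, represented as sets \<open>{x, y}\<close>. Loops are not excluded, and the
  graph may be infinite, of any cardinality and not locally finite. All sums are taken in
  \<^typ>\<open>ennreal\<close>, where every family is summable and \<open>inverse\<close> obeys the conventions
  \<open>1/0 = \<infinity>\<close> and \<open>1/\<infinity> = 0\<close>.\<close>

definition electrical_network :: "'v set \<Rightarrow> 'v set set \<Rightarrow> ('v set \<Rightarrow> real) \<Rightarrow> bool" where
  "electrical_network V E C \<longleftrightarrow>
     (\<forall>e\<in>E. \<exists>x\<in>V. \<exists>y\<in>V. e = {x, y}) \<and> (\<forall>e\<in>E. 0 < C e)"

definition resistance :: "('v set \<Rightarrow> real) \<Rightarrow> 'v set \<Rightarrow> real" where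
  "resistance C e = inverse (C e)"

definition sq_diff :: "('v \<Rightarrow> real) \<Rightarrow> 'v set \<Rightarrow> real" where
  "sq_diff f e = (THE d. \<exists>x y. e = {x, y} \<and> d = (f x - f y)\<^sup>2)"

lemma sq_diff_insert [simp]: "sq_diff f {x, y} = (f x - f y)\<^sup>2"
  unfolding sq_diff_def
  by (rule the_equality) (auto simp: doubleton_eq_iff power2_commute)

definition energy :: "'v set set \<Rightarrow> ('v set \<Rightarrow> real) \<Rightarrow> ('v \<Rightarrow> real) \<Rightarrow> ennreal" where
  "energy E C f = (\<Sum>\<^sub>\<infinity>e\<in>E. ennreal (C e * sq_diff f e))"

text \<open>The potentials are total functions on \<open>'v\<close>; for an electrical network and \<open>A, B \<subseteq> V\<close>
  their values outside \<open>V\<close> do not matter.\<close>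

definition eff_resistance ::
    "'v set set \<Rightarrow> ('v set \<Rightarrow> real) \<Rightarrow> 'v set \<Rightarrow> 'v set \<Rightarrow> ennreal" where
  "eff_resistance E C A B =
     inverse (INF f \<in> {f. (\<forall>x\<in>A. f x = 0) \<and> (\<forall>x\<in>B. f x = 1)}. energy E C f)"

definition path_edges :: "'v list \<Rightarrow> 'v set set" where
  "path_edges p = {{p ! k, p ! Suc k} | k. Suc k < length p}"

definition is_path :: "'v set \<Rightarrow> 'v set set \<Rightarrow> 'v list \<Rightarrow> bool" where
  "is_path V E p \<longleftrightarrow> p \<noteq> [] \<and> set p \<subseteq> V \<and> distinct p \<and> path_edges p \<subseteq> E"

definition cutset :: "'v set \<Rightarrow> 'v set set \<Rightarrow> 'v set \<Rightarrow> 'v set \<Rightarrow> 'v set set \<Rightarrow> bool" where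
  "cutset V E A B S \<longleftrightarrow>
     S \<subseteq> E \<and> (\<forall>p. is_path V E p \<and> hd p \<in> A \<and> last p \<in> B \<longrightarrow> path_edges p \<inter> S \<noteq> {})"

definition resistance_allocation ::
    "'v set set \<Rightarrow> ('v set \<Rightarrow> real) \<Rightarrow> 'i set \<Rightarrow> ('i \<Rightarrow> 'v set set) \<Rightarrow> ('v set \<Rightarrow> 'i \<Rightarrow> real) \<Rightarrow> bool"
  where
  "resistance_allocation E C I S R \<longleftrightarrow>
     (\<forall>e\<in>E. \<forall>i\<in>I. 0 \<le> R e i) \<and>
     (\<forall>e\<in>E. (\<Sum>\<^sub>\<infinity>i\<in>I. ennreal (R e i)) \<le> ennreal (resistance C e)) \<and>
     (\<forall>e\<in>E. \<forall>i\<in>I. e \<notin> S i \<longrightarrow> R e i = 0)"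

definition split_conductance ::
    "('i \<Rightarrow> 'v set set) \<Rightarrow> ('v set \<Rightarrow> 'i \<Rightarrow> real) \<Rightarrow> 'i \<Rightarrow> ennreal" where
  "split_conductance S R i = (\<Sum>\<^sub>\<infinity>e\<in>S i. inverse (ennreal (R e i)))"

text \<open>A collection of cutsets is a family \<open>S\<close> indexed by an arbitrary set \<open>I\<close>, so cutsets may
  be repeated.\<close>

definition allocated_cutsets ::
    "'v set \<Rightarrow> 'v set set \<Rightarrow> ('v set \<Rightarrow> real) \<Rightarrow> 'v set \<Rightarrow> 'v set \<Rightarrow>
     ('i set \<times> ('i \<Rightarrow> 'v set set) \<times> ('v set \<Rightarrow> 'i \<Rightarrow> real)) set" where
  "allocated_cutsets V E C A B =
     {(I, S, R). (\<forall>i\<in>I. cutset V E A B (S i)) \<and> resistance_allocation E C I S R}"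

text \<open>In statements about a supremum over \<^const>\<open>allocated_cutsets\<close>, the type \<open>'i\<close> bounds the
  size of the collections. It must be large enough for the supremum to run over all of them
  (over \<^typ>\<open>unit\<close> only single cutsets would be available), hence the side condition
  \<open>infinite (UNIV :: 'i set)\<close> there; the type is otherwise arbitrary.\<close>

end

theory Submission
  imports Defs
begin

text \<open>
  Both halves come from one dictionary: a set of edges is a cutset between \<open>A\<close> and \<open>B\<close> exactly when
  it contains the edge boundary of some vertex set \<open>D\<close> with \<open>B \<subseteq> D\<close> and \<open>A \<inter> D = {}\<close>
  (\<open>cutset_iff_edge_boundary\<close>). The indicator function of \<open>D\<close> is then a potential with the right
  boundary values whose gradient lives on the cutset.

  The inequality. Since \<open>Res\<close> is the inverse of an infimum of energies, a lower bound for it needs one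
  potential of small energy. Let \<open>c\<^sub>i = 1/C(S\<^sub>i)\<close>, take finitely many \<open>i\<close> with \<open>0 < c\<^sub>i < \<infinity>\<close>, and let
  \<open>T\<close> be the sum of these \<open>c\<^sub>i\<close>. The average of the indicators of the sets \<open>D\<^sub>i\<close>
  with weights \<open>w\<^sub>i = c\<^sub>i/T\<close> jumps across an edge \<open>e\<close> by at most the sum of the \<open>w\<^sub>i\<close> over the cutsets
  containing \<open>e\<close>. By Cauchy-Schwarz the square of this sum is at most
  \<open>(\<Sum>\<^sub>i R\<^sub>e\<^sub>i) (\<Sum>\<^sub>i w\<^sub>i\<^sup>2/R\<^sub>e\<^sub>i)\<close>, and the first factor is at most \<open>R\<^sub>e = 1/C\<^sub>e\<close>. Summing over the
  edges bounds the energy by \<open>\<Sum>\<^sub>i w\<^sub>i\<^sup>2 C(S\<^sub>i)\<close> (\<open>energy_layered_potential_le\<close>), which is \<open>1/T\<close>.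
  If some \<open>C(S\<^sub>i)\<close> vanishes, the indicator of \<open>D\<^sub>i\<close> alone has energy zero.

  Attainment on finite graphs. By compactness there is a potential \<open>f\<close> of least energy \<open>m\<close>, with values
  in \<open>[0,1]\<close>. Let \<open>0 = t\<^sub>0 < \<dots> < t\<^sub>n = 1\<close> be its values on \<open>V\<close>, and cut the graph between any two
  consecutive ones. An edge on which \<open>f\<close> rises from \<open>t\<^sub>a\<close> to \<open>t\<^sub>b\<close> crosses the cuts \<open>a, \<dots>, b-1\<close>, and
  its resistance is divided among them in proportion to the increments \<open>t\<^sub>k\<^sub>+\<^sub>1 - t\<^sub>k\<close>; these add up
  to \<open>t\<^sub>b - t\<^sub>a\<close>, so this is an allocation. The split conductance of the \<open>k\<close>-th cut is then the current
  of \<open>f\<close> through it divided by \<open>t\<^sub>k\<^sub>+\<^sub>1 - t\<^sub>k\<close>. Every level cut carries the same current, namely \<open>m\<close>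
  (\<open>current_through_level_cut\<close>), so the inverses of the split conductances telescope to \<open>1/m\<close>.
\<close>

section \<open>Cutsets as edge boundaries\<close>

definition edge_boundary :: "'v set set \<Rightarrow> 'v set \<Rightarrow> 'v set set" where
  "edge_boundary E D = {e \<in> E. e \<inter> D \<noteq> {} \<and> \<not> e \<subseteq> D}"

lemma path_edges_snoc:
  assumes "p \<noteq> []"
  shows "path_edges (p @ [y]) = insert {last p, y} (path_edges p)"
proof (intro set_eqI iffI)
  fix e assume "e \<in> path_edges (p @ [y])"
  then obtain k where k: "k < length p" "e = {(p @ [y]) ! k, (p @ [y]) ! Suc k}"
    by (auto simp: path_edges_def)
  show "e \<in> insert {last p, y} (path_edges p)"
  proof (cases "Suc k < length p")
    case True
    with k show ?thesis by (auto simp: path_edges_def nth_append)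
  next
    case False
    with k have "k = length p - 1" by simp
    with k assms show ?thesis by (simp add: nth_append last_conv_nth)
  qed
next
  fix e assume "e \<in> insert {last p, y} (path_edges p)"
  then consider "e = {last p, y}" | k where "Suc k < length p" "e = {p ! k, p ! Suc k}"
    by (auto simp: path_edges_def)
  then show "e \<in> path_edges (p @ [y])"
  proof cases
    case 1
    then have "e = {(p @ [y]) ! (length p - 1), (p @ [y]) ! Suc (length p - 1)}"
      using assms by (simp add: nth_append last_conv_nth)
    moreover have "Suc (length p - 1) < length (p @ [y])" using assms by simp
    ultimately show ?thesis unfolding path_edges_def by blast
  next
    case 2
    then have "e = {(p @ [y]) ! k, (p @ [y]) ! Suc k}" "Suc k < length (p @ [y])"
      by (auto simp: nth_append)
    then show ?thesis unfolding path_edges_def by blast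
  qed
qed

lemma path_edges_take: "path_edges (take n p) \<subseteq> path_edges p"
  unfolding path_edges_def by fastforce

text \<open>Paths do not repeat vertices. When \<open>y\<close> already lies on the path, the extension is therefore the
  initial segment that ends at \<open>y\<close>.\<close>

lemma path_extend:
  assumes "is_path V E p" "path_edges p \<inter> S = {}" "{last p, y} \<in> E" "{last p, y} \<notin> S" "y \<in> V"
  obtains q where "is_path V E q" "path_edges q \<inter> S = {}" "hd q = hd p" "last q = y"
proof (cases "y \<in> set p")
  case True
  then obtain n where n: "n < length p" "p ! n = y" by (auto simp: in_set_conv_nth)
  let ?q = "take (Suc n) p"
  have "last ?q = y" using n by (simp add: take_Suc_conv_app_nth)
  moreover have "hd ?q = hd p" using n by simp
  moreover have "is_path V E ?q"
    using assms(1) n path_edges_take[of "Suc n" p] set_take_subset[of "Suc n" p]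
    by (auto simp: is_path_def)
  ultimately show ?thesis using that[of ?q] path_edges_take[of "Suc n" p] assms(2) by blast
next
  case False
  have "p \<noteq> []" using assms(1) by (simp add: is_path_def)
  then show ?thesis
    using assms False by (intro that[of "p @ [y]"]) (auto simp: is_path_def path_edges_snoc)
qed

text \<open>Given a cutset, \<open>D\<close> is the set of points that no path from \<open>A\<close> avoiding \<open>S\<close> reaches: an edge
  from the reachable side into \<open>D\<close> lies in \<open>S\<close>, since it would otherwise extend such a path.
  Conversely, a path that avoids the boundary of \<open>D\<close> never enters \<open>D\<close>.\<close>

lemma cutset_iff_edge_boundary:
  assumes "electrical_network V E C" "A \<subseteq> V"
  shows "cutset V E A B S \<longleftrightarrow>
    S \<subseteq> E \<and> (\<exists>D. A \<inter> D = {} \<and> B \<subseteq> D \<and> edge_boundary E D \<subseteq> S)"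
proof
  assume cut: "cutset V E A B S"
  define D where
    "D = {x. \<nexists>p. is_path V E p \<and> path_edges p \<inter> S = {} \<and> hd p \<in> A \<and> last p = x}"
  have "A \<inter> D = {}"
  proof -
    have "x \<notin> D" if "x \<in> A" for x
    proof -
      have "is_path V E [x]" "path_edges [x] \<inter> S = {}"
        using that assms(2) by (auto simp: is_path_def path_edges_def)
      with that show ?thesis unfolding D_def by force
    qed
    then show ?thesis by blast
  qed
  moreover have "B \<subseteq> D" using cut unfolding cutset_def D_def by blast
  moreover have "edge_boundary E D \<subseteq> S"
  proof
    fix e assume e: "e \<in> edge_boundary E D"
    then have eE: "e \<in> E" by (simp add: edge_boundary_def)
    then obtain u v where uv: "u \<in> V" "v \<in> V" "e = {u, v}"
      using assms(1) by (auto simp: electrical_network_def)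
    have "u \<in> D \<and> v \<notin> D \<or> u \<notin> D \<and> v \<in> D"
      using e uv(3) by (auto simp: edge_boundary_def)
    then obtain x y where xy: "y \<in> V" "e = {x, y}" "x \<notin> D" "y \<in> D"
      using uv by (metis insert_commute)
    obtain p where p: "is_path V E p" "path_edges p \<inter> S = {}" "hd p \<in> A" "last p = x"
      using xy(3) by (auto simp: D_def)
    show "e \<in> S"
    proof (rule ccontr)
      assume "e \<notin> S"
      then obtain q where "is_path V E q" "path_edges q \<inter> S = {}" "hd q = hd p" "last q = y"
        using path_extend[OF p(1,2), of y] p(4) xy eE by metis
      with p(3) xy(4) show False by (auto simp: D_def)
    qed
  qed
  ultimately show "S \<subseteq> E \<and> (\<exists>D. A \<inter> D = {} \<and> B \<subseteq> D \<and> edge_boundary E D \<subseteq> S)"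
    using cut by (auto simp: cutset_def)
next
  assume "S \<subseteq> E \<and> (\<exists>D. A \<inter> D = {} \<and> B \<subseteq> D \<and> edge_boundary E D \<subseteq> S)"
  then obtain D where D: "S \<subseteq> E" "A \<inter> D = {}" "B \<subseteq> D" "edge_boundary E D \<subseteq> S" by blast
  have "path_edges p \<inter> S \<noteq> {}" if p: "is_path V E p" "hd p \<in> A" "last p \<in> B" for p
  proof
    assume avoid: "path_edges p \<inter> S = {}"
    have "p ! k \<notin> D" if "k < length p" for k
      using that
    proof (induction k)
      case 0
      then have "p ! 0 \<in> A" using p by (simp add: is_path_def hd_conv_nth)
      then show ?case using D by blast
    next
      case (Suc k)
      then have "{p ! k, p ! Suc k} \<in> path_edges p" by (auto simp: path_edges_def)
      then have "{p ! k, p ! Suc k} \<in> E - S" using p avoid by (auto simp: is_path_def)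
      with Suc D(4) show ?case by (auto simp: edge_boundary_def)
    qed
    moreover have "p \<noteq> []" using p by (simp add: is_path_def)
    ultimately have "last p \<notin> D" by (simp add: last_conv_nth)
    with p(3) D show False by blast
  qed
  with D show "cutset V E A B S" by (auto simp: cutset_def)
qed

section \<open>The lower bound for the effective resistance\<close>

lemma ennreal_inverse_le_inverse:
  fixes a b :: ennreal
  assumes "a \<le> b"
  shows "inverse b \<le> inverse a"
proof (cases "a = 0 \<or> b = top")
  case False
  then obtain r s where "a = ennreal r" "b = ennreal s" "0 < r" "0 < s"
    using assms by (cases a; cases b) (auto simp: top_unique less_le ennreal_eq_0_iff)
  with assms show ?thesis by (simp add: inverse_ennreal le_imp_inverse_le)
qed auto

lemma infsum_ennreal_le:
  fixes f :: "'a \<Rightarrow> ennreal"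
  assumes "\<And>F. finite F \<Longrightarrow> F \<subseteq> A \<Longrightarrow> sum f F \<le> b"
  shows "infsum f A \<le> b"
  unfolding nonneg_infsum_complete[of A f, OF zero_le] using assms by (intro SUP_least) auto

lemma eff_resistance_ge_inverse_energy:
  assumes "\<forall>x\<in>A. f x = 0" "\<forall>x\<in>B. f x = 1" 
  shows "inverse (energy E C f) \<le> eff_resistance E C A B"
  unfolding eff_resistance_def
  by (rule ennreal_inverse_le_inverse, rule INF_lower) (use assms in auto)

lemma square_sum_le_weighted:
  fixes w r :: "'a \<Rightarrow> real"
  assumes "finite J" "\<And>i. i \<in> J \<Longrightarrow> 0 < r i"
  shows "(\<Sum>i\<in>J. w i)\<^sup>2 \<le> (\<Sum>i\<in>J. r i) * (\<Sum>i\<in>J. (w i)\<^sup>2 / r i)"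
proof -
  have "(\<Sum>i\<in>J. sqrt (r i) * (w i / sqrt (r i))) = (\<Sum>i\<in>J. w i)"
    using assms(2) by (intro sum.cong) force+
  moreover have "(\<Sum>i\<in>J. (sqrt (r i))\<^sup>2) = (\<Sum>i\<in>J. r i)"
    using assms by (intro sum.cong) (auto dest: less_imp_le)
  moreover have "(\<Sum>i\<in>J. (w i / sqrt (r i))\<^sup>2) = (\<Sum>i\<in>J. (w i)\<^sup>2 / r i)"
    using assms by (intro sum.cong) (auto simp: power_divide less_imp_le)
  ultimately show ?thesis
    using Cauchy_Schwarz_ineq_sum[of "\<lambda>i. sqrt (r i)" "\<lambda>i. w i / sqrt (r i)" J] by simp
qed

text \<open>The value \<open>R e i = 0\<close> on an edge of \<open>S i\<close> makes the right-hand side infinite, because the weight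
  \<open>w i\<close> is positive; on all other edges the bound is Cauchy-Schwarz with the shares \<open>R e i\<close>, whose
  sum is at most \<open>1/C e\<close>.\<close>

lemma energy_layered_potential_le:
  fixes S :: "'i \<Rightarrow> 'v set set" and w :: "'i \<Rightarrow> real"
  assumes net: "electrical_network V E C" and R: "resistance_allocation E C I S R"
    and F: "finite F" "F \<subseteq> I" and w: "\<And>i. i \<in> F \<Longrightarrow> 0 < w i"
    and S: "\<And>i. i \<in> F \<Longrightarrow> S i \<subseteq> E" and D: "\<And>i. i \<in> F \<Longrightarrow> edge_boundary E (D i) \<subseteq> S i"
  shows "energy E C (\<lambda>x. \<Sum>i\<in>F. w i * indicator (D i) x)
    \<le> (\<Sum>i\<in>F. ennreal ((w i)\<^sup>2) * split_conductance S R i)"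
proof -
  let ?f = "\<lambda>x. \<Sum>i\<in>F. w i * indicator (D i) x :: real"
  let ?g = "\<lambda>i e. if e \<in> S i then inverse (ennreal (R e i)) else 0"
  have edge: "ennreal (C e * sq_diff ?f e) \<le> (\<Sum>i\<in>F. ennreal ((w i)\<^sup>2) * ?g i e)"
    if e: "e \<in> E" for e
  proof (cases "\<exists>i\<in>F. e \<in> S i \<and> R e i = 0")
    case True
    then obtain i where i: "i \<in> F" "e \<in> S i" "R e i = 0" by blast
    have "ennreal ((w i)\<^sup>2) * ?g i e = top"
      using i w[of i] by (simp add: ennreal_mult_top)
    then have "(\<Sum>i\<in>F. ennreal ((w i)\<^sup>2) * ?g i e) = top"
      using i F by (subst sum.remove) auto
    then show ?thesis by simp
  next
    case False
    define J where "J = {i \<in> F. e \<in> S i}"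
    have J: "finite J" "J \<subseteq> F" using F by (auto simp: J_def)
    have Rpos: "0 < R e i" if "i \<in> J" for i
      using that False R e F unfolding J_def resistance_allocation_def
      by (metis (mono_tags, lifting) less_eq_real_def mem_Collect_eq subsetD)
    obtain x y where xy: "e = {x, y}"
      using net e by (auto simp: electrical_network_def)
    have Ce: "0 < C e" using net e by (simp add: electrical_network_def)
    have "ennreal (\<Sum>i\<in>J. R e i) = (\<Sum>\<^sub>\<infinity>i\<in>J. ennreal (R e i))"
      using J Rpos by (simp add: less_imp_le)
    also have "\<dots> \<le> (\<Sum>\<^sub>\<infinity>i\<in>I. ennreal (R e i))"
      using J F by (intro infsum_mono_neutral nonneg_summable_on_complete) auto
    also have "\<dots> \<le> ennreal (resistance C e)"
      using R e by (simp add: resistance_allocation_def)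
    finally have RJ: "(\<Sum>i\<in>J. R e i) \<le> inverse (C e)"
      using Ce by (simp add: resistance_def ennreal_le_iff)
    have "\<bar>?f x - ?f y\<bar> = \<bar>\<Sum>i\<in>F. w i * (indicator (D i) x - indicator (D i) y)\<bar>"
      by (simp add: sum_subtractf algebra_simps)
    also have "\<dots> \<le> (\<Sum>i\<in>F. \<bar>w i * (indicator (D i) x - indicator (D i) y)\<bar>)"
      by (rule sum_abs)
    also have "\<dots> \<le> (\<Sum>i\<in>F. if e \<in> S i then w i else 0)"
    proof (rule sum_mono)
      fix i assume i: "i \<in> F"
      show "\<bar>w i * (indicator (D i) x - indicator (D i) y)\<bar> \<le> (if e \<in> S i then w i else 0)"
        using D[OF i] w[OF i] e xy by (auto simp: edge_boundary_def indicator_def)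
    qed
    also have "\<dots> = (\<Sum>i\<in>J. w i)"
      using F by (simp add: J_def sum.If_cases Int_def)
    finally have "\<bar>?f x - ?f y\<bar>\<^sup>2 \<le> (\<Sum>i\<in>J. w i)\<^sup>2"
      by (intro power_mono abs_ge_zero)
    then have "sq_diff ?f e \<le> (\<Sum>i\<in>J. w i)\<^sup>2"
      by (simp only: xy sq_diff_insert power2_abs)
    also have "\<dots> \<le> (\<Sum>i\<in>J. R e i) * (\<Sum>i\<in>J. (w i)\<^sup>2 / R e i)"
      using J Rpos by (intro square_sum_le_weighted) auto
    also have "\<dots> \<le> inverse (C e) * (\<Sum>i\<in>J. (w i)\<^sup>2 / R e i)"
      by (intro mult_right_mono[OF RJ] sum_nonneg divide_nonneg_pos Rpos) auto
    finally have "C e * sq_diff ?f e \<le> C e * (inverse (C e) * (\<Sum>i\<in>J. (w i)\<^sup>2 / R e i))"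
      using Ce by (intro mult_left_mono) auto
    then have "C e * sq_diff ?f e \<le> (\<Sum>i\<in>J. (w i)\<^sup>2 / R e i)"
      using Ce by (simp only: mult.assoc[symmetric] right_inverse[OF less_imp_neq[OF Ce, symmetric]] mult_1)
    then have "ennreal (C e * sq_diff ?f e) \<le> ennreal (\<Sum>i\<in>J. (w i)\<^sup>2 / R e i)"
      by (rule ennreal_leI)
    also have "\<dots> = (\<Sum>i\<in>J. ennreal ((w i)\<^sup>2 / R e i))"
      using Rpos by (intro sum_ennreal[symmetric]) (auto simp: less_imp_le)
    also have "\<dots> = (\<Sum>i\<in>J. ennreal ((w i)\<^sup>2) * ?g i e)"
      using Rpos by (intro sum.cong)
        (auto simp: J_def inverse_ennreal divide_inverse ennreal_mult less_imp_le)
    also have "\<dots> = (\<Sum>i\<in>F. ennreal ((w i)\<^sup>2) * ?g i e)"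
      using F by (intro sum.mono_neutral_left) (auto simp: J_def)
    finally show ?thesis .
  qed
  have "(\<Sum>e\<in>X. ennreal (C e * sq_diff ?f e)) \<le> (\<Sum>i\<in>F. ennreal ((w i)\<^sup>2) * split_conductance S R i)"
    if X: "finite X" "X \<subseteq> E" for X
  proof -
    have "(\<Sum>e\<in>X. ennreal (C e * sq_diff ?f e)) \<le> (\<Sum>e\<in>X. \<Sum>i\<in>F. ennreal ((w i)\<^sup>2) * ?g i e)"
      using X edge by (intro sum_mono) auto
    also have "\<dots> = (\<Sum>i\<in>F. ennreal ((w i)\<^sup>2) * (\<Sum>e\<in>X. ?g i e))"
      by (subst sum.swap) (simp add: sum_distrib_left)
    also have "\<dots> \<le> (\<Sum>i\<in>F. ennreal ((w i)\<^sup>2) * split_conductance S R i)"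
    proof (intro sum_mono mult_left_mono)
      fix i assume "i \<in> F"
      have "(\<Sum>e\<in>X. ?g i e) = (\<Sum>\<^sub>\<infinity>e\<in>X. ?g i e)" using X by simp
      also have "\<dots> \<le> split_conductance S R i"
        unfolding split_conductance_def
          by (intro infsum_mono_neutral nonneg_summable_on_complete) auto
      finally show "(\<Sum>e\<in>X. ?g i e) \<le> split_conductance S R i" .
    qed auto
    finally show ?thesis .
  qed
  then show ?thesis
    unfolding energy_def by (rule infsum_ennreal_le)
qed

text \<open>The weights are proportional to \<open>1/C(S\<^sub>i)\<close> because this choice minimises
  \<open>\<Sum>\<^sub>i w\<^sub>i\<^sup>2 C(S\<^sub>i)\<close> among weights with sum 1.\<close>

theorem sum_inverse_split_conductance_le_eff_resistance:
  assumes net: "electrical_network V E C" and A: "A \<subseteq> V"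
    and cut: "\<And>i. i \<in> I \<Longrightarrow> cutset V E A B (S i)"
    and R: "resistance_allocation E C I S R"
  shows "(\<Sum>\<^sub>\<infinity>i\<in>I. inverse (split_conductance S R i)) \<le> eff_resistance E C A B"
proof (rule infsum_ennreal_le)
  have "\<forall>i\<in>I. \<exists>D. A \<inter> D = {} \<and> B \<subseteq> D \<and> edge_boundary E D \<subseteq> S i \<and> S i \<subseteq> E"
  proof
    fix i assume "i \<in> I"
    from cut[OF this] show "\<exists>D. A \<inter> D = {} \<and> B \<subseteq> D \<and> edge_boundary E D \<subseteq> S i \<and> S i \<subseteq> E"
      unfolding cutset_iff_edge_boundary[OF net A] by blast
  qed
  from bchoice[OF this] obtain D where
    D: "\<forall>i\<in>I. A \<inter> D i = {} \<and> B \<subseteq> D i \<and> edge_boundary E (D i) \<subseteq> S i \<and> S i \<subseteq> E" ..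
  let ?c = "\<lambda>i. inverse (split_conductance S R i)"
  fix F assume F: "finite F" "F \<subseteq> I"
  show "(\<Sum>i\<in>F. ?c i) \<le> eff_resistance E C A B"
  proof (cases "\<exists>i\<in>F. split_conductance S R i = 0")
    case True
    then obtain i where i: "i \<in> F" "split_conductance S R i = 0" by blast
    with F have iI: "i \<in> I" by blast
    have "energy E C (\<lambda>x. \<Sum>j\<in>{i}. 1 * indicator (D j) x)
        \<le> (\<Sum>j\<in>{i}. ennreal (1\<^sup>2) * split_conductance S R j)"
      using iI bspec[OF D iI] by (intro energy_layered_potential_le[OF net R, of "{i}"]) auto
    then have "energy E C (indicator (D i)) = 0" using i by simp
    moreover have "A \<inter> D i = {}" "B \<subseteq> D i" using bspec[OF D iI] by auto
    then have "inverse (energy E C (indicator (D i))) \<le> eff_resistance E C A B"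
      by (intro eff_resistance_ge_inverse_energy) (auto simp: indicator_def)
    ultimately have "eff_resistance E C A B = top" by (simp add: top_unique)
    then show ?thesis by simp
  next
    case False
    (* Cutsets of infinite split conductance contribute nothing and would get weight zero. *)
    define G where "G = {i \<in> F. ?c i \<noteq> 0}"
    have G: "finite G" "G \<subseteq> I" using F by (auto simp: G_def)
    define r where "r i = enn2real (?c i)" for i
    have cr: "?c i = ennreal (r i)" "0 < r i" if "i \<in> G" for i
    proof -
      have "?c i \<noteq> top" "?c i \<noteq> 0"
        using that False unfolding G_def ennreal_inverse_eq_top_iff by blast+
      then have "?c i < top" "0 < ?c i"
        by (simp_all only: less_top zero_less_iff_neq_zero not_False_eq_True)
      then show "?c i = ennreal (r i)" "0 < r i"
        by (auto simp: r_def enn2real_positive_iff)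
    qed
    have cinv: "split_conductance S R i = ennreal (1 / r i)" if iG: "i \<in> G" for i
    proof -
      have "split_conductance S R i \<noteq> 0" using False iG by (auto simp: G_def)
      with cr[OF iG] obtain s where "split_conductance S R i = ennreal s" "0 < s"
        by (cases "split_conductance S R i") (auto simp: less_le)
      with cr[OF iG] show ?thesis by (simp add: inverse_ennreal field_simps)
    qed
    define T where "T = (\<Sum>i\<in>G. r i)"
    have sum_eq: "(\<Sum>i\<in>F. ?c i) = ennreal T"
    proof -
      have "(\<Sum>i\<in>F. ?c i) = (\<Sum>i\<in>G. ?c i)"
        using F by (intro sum.mono_neutral_right) (auto simp: G_def)
      also have "\<dots> = (\<Sum>i\<in>G. ennreal (r i))" using cr by (intro sum.cong) auto
      also have "\<dots> = ennreal T" unfolding T_def using cr by (intro sum_ennreal) (auto simp: less_imp_le)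
      finally show ?thesis .
    qed
    show ?thesis
    proof (cases "G = {}")
      case True
      then show ?thesis using sum_eq by (simp add: T_def)
    next
      case ne: False
      have T: "0 < T" unfolding T_def using G ne cr by (intro sum_pos) auto
      let ?f = "\<lambda>x. \<Sum>i\<in>G. r i / T * indicator (D i) x :: real"
      have "energy E C ?f \<le> (\<Sum>i\<in>G. ennreal ((r i / T)\<^sup>2) * split_conductance S R i)"
      proof (rule energy_layered_potential_le[OF net R G])
        fix i assume i: "i \<in> G"
        with G(2) have "i \<in> I" by blast
        from bspec[OF D this] show "S i \<subseteq> E" "edge_boundary E (D i) \<subseteq> S i" by blast+
        show "0 < r i / T" using cr(2)[OF i] T by simp
      qed
      also have "\<dots> = (\<Sum>i\<in>G. ennreal (r i / T\<^sup>2))"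
        using cinv cr T by (intro sum.cong)
          (auto simp: ennreal_mult'[symmetric] power2_eq_square less_imp_le dest: less_imp_neq)
      also have "\<dots> = ennreal (\<Sum>i\<in>G. r i / T\<^sup>2)"
        using cr by (intro sum_ennreal) (auto simp: less_imp_le)
      also have "(\<Sum>i\<in>G. r i / T\<^sup>2) = inverse T"
        using T by (simp add: T_def[symmetric] sum_divide_distrib[symmetric] power2_eq_square field_simps)
      finally have "inverse (ennreal (inverse T)) \<le> inverse (energy E C ?f)"
        by (rule ennreal_inverse_le_inverse)
      then have "ennreal T \<le> inverse (energy E C ?f)" using T by (simp add: inverse_ennreal)
      also have "\<dots> \<le> eff_resistance E C A B"
      proof (rule eff_resistance_ge_inverse_energy)
        have on_A: "indicator (D i) x = (0::real)" if "x \<in> A" "i \<in> G" for x i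
          using bspec[OF D subsetD[OF G(2) that(2)]] that(1) by (auto simp: indicator_def)
        have on_B: "indicator (D i) x = (1::real)" if "x \<in> B" "i \<in> G" for x i
          using bspec[OF D subsetD[OF G(2) that(2)]] that(1) by (auto simp: indicator_def)
        show "\<forall>x\<in>A. ?f x = 0" using on_A by simp
        have "(\<Sum>i\<in>G. r i / T) = 1" using T by (simp add: T_def sum_divide_distrib[symmetric])
        then show "\<forall>x\<in>B. ?f x = 1" using on_B by simp
      qed
      finally show ?thesis using sum_eq by simp
    qed
  qed
qed

section \<open>Potentials of least energy and their level cuts\<close>

text \<open>On a finite graph the energy is a real number, and this is the form in which it can be
  perturbed and minimised.\<close>

definition dirichlet :: "'v set set \<Rightarrow> ('v set \<Rightarrow> real) \<Rightarrow> ('v \<Rightarrow> real) \<Rightarrow> real" where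
  "dirichlet E C f = (\<Sum>e\<in>E. C e * sq_diff f e)"

lemma sq_diff_nonneg:
  assumes "electrical_network V E C" "e \<in> E"
  shows "0 \<le> sq_diff f e"
  using assms by (auto simp: electrical_network_def)

lemma sq_diff_scale:
  assumes "electrical_network V E C" "e \<in> E"
  shows "sq_diff (\<lambda>x. f x / c) e = sq_diff f e / c\<^sup>2"
proof -
  obtain x y where e: "e = {x, y}" using assms by (auto simp: electrical_network_def)
  show ?thesis
    unfolding e sq_diff_insert by (simp add: diff_divide_distrib[symmetric] power_divide)
qed

lemma energy_eq_dirichlet:
  assumes "electrical_network V E C" "finite E"
  shows "energy E C f = ennreal (dirichlet E C f)"
  using assms(2) sq_diff_nonneg[OF assms(1)] assms(1)
  by (simp add: energy_def dirichlet_def electrical_network_def sum_ennreal less_imp_le)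

lemma dirichlet_nonneg:
  assumes "electrical_network V E C"
  shows "0 \<le> dirichlet E C f"
  unfolding dirichlet_def using sq_diff_nonneg[OF assms] assms
  by (intro sum_nonneg) (simp add: electrical_network_def less_imp_le)

lemma dirichlet_scale:
  assumes "electrical_network V E C"
  shows "dirichlet E C (\<lambda>x. f x / c) = dirichlet E C f / c\<^sup>2"
  by (simp add: dirichlet_def sum_divide_distrib sq_diff_scale[OF assms])

lemma dirichlet_clamp_le:
  assumes "electrical_network V E C"
  shows "dirichlet E C (\<lambda>x. max 0 (min 1 (f x))) \<le> dirichlet E C f"
  unfolding dirichlet_def
proof (rule sum_mono)
  fix e assume e: "e \<in> E"
  then obtain x y where xy: "e = {x, y}" using assms by (auto simp: electrical_network_def)
  have "\<bar>max 0 (min 1 (f x)) - max 0 (min 1 (f y))\<bar> \<le> \<bar>f x - f y\<bar>" by linarith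
  then have "(max 0 (min 1 (f x)) - max 0 (min 1 (f y)))\<^sup>2 \<le> (f x - f y)\<^sup>2"
    by (simp only: abs_le_square_iff)
  then show "C e * sq_diff (\<lambda>x. max 0 (min 1 (f x))) e \<le> C e * sq_diff f e"
    using e assms unfolding xy sq_diff_insert
    by (intro mult_left_mono) (auto simp: electrical_network_def less_imp_le)
qed

lemma continuous_on_dirichlet:
  fixes E :: "'v set set"
  assumes "electrical_network V E C"
  shows "continuous_on X (dirichlet E C)"
proof -
  have "continuous_on X (\<lambda>f. sq_diff f e)" if eE: "e \<in> E" for e :: "'v set"
  proof -
    obtain x y where e: "e = {x, y}" using assms eE by (auto simp: electrical_network_def)
    have "continuous_on X (\<lambda>f. f z)" for z :: 'v
      by (rule continuous_on_subset[OF continuous_on_product_coordinates]) simp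
    then show ?thesis unfolding e sq_diff_insert by (intro continuous_intros)
  qed
  then show ?thesis unfolding dirichlet_def by (intro continuous_intros)
qed

text \<open>Clamping to \<open>[0,1]\<close> does not increase the energy, so it suffices to minimise over the potentials
  with values in \<open>[0,1]\<close>. They form a product of compact sets, on which the energy is continuous
  because each edge depends on two coordinates only.\<close>

lemma ex_minimal_potential:
  assumes net: "electrical_network V E C" and disj: "A \<inter> B = {}"
  obtains f where "\<forall>x\<in>A. f x = 0" "\<forall>x\<in>B. f x = 1" "\<forall>x. 0 \<le> f x \<and> f x \<le> 1"
    "\<And>g. \<forall>x\<in>A. g x = 0 \<Longrightarrow> \<forall>x\<in>B. g x = 1 \<Longrightarrow> dirichlet E C f \<le> dirichlet E C g"
proof -
  define T where "T x = (if x \<in> A then {0} else if x \<in> B then {1} else {0..1::real})" for x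
  define K where "K = PiE UNIV T"
  have K_iff: "f \<in> K \<longleftrightarrow>
      (\<forall>x\<in>A. f x = 0) \<and> (\<forall>x\<in>B. f x = 1) \<and> (\<forall>x. 0 \<le> f x \<and> f x \<le> 1)" for f
  proof -
    have "f x \<in> T x \<longleftrightarrow> (x \<in> A \<longrightarrow> f x = 0) \<and> (x \<in> B \<longrightarrow> f x = 1) \<and> 0 \<le> f x \<and> f x \<le> 1" for x
      using disj by (auto simp: T_def)
    then show ?thesis unfolding K_def by (simp add: PiE_iff) blast
  qed
  have "compactin (product_topology (\<lambda>_. euclidean) UNIV) K"
    unfolding K_def compactin_PiE by (auto simp: T_def)
  then have "compact K" by (simp add: euclidean_product_topology)
  moreover have "indicator B \<in> K" using disj by (auto simp: K_iff indicator_def)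
  ultimately obtain f where f: "f \<in> K" "\<And>g. g \<in> K \<Longrightarrow> dirichlet E C f \<le> dirichlet E C g"
    using continuous_attains_inf[OF _ _ continuous_on_dirichlet[OF net], of K] by blast
  have "dirichlet E C f \<le> dirichlet E C g" if "\<forall>x\<in>A. g x = 0" "\<forall>x\<in>B. g x = 1" for g
  proof -
    have "(\<lambda>x. max 0 (min 1 (g x))) \<in> K" using that by (auto simp: K_iff)
    then show ?thesis using f(2) dirichlet_clamp_le[OF net] by (meson order_trans)
  qed
  with f(1) that show ?thesis by (auto simp: K_iff)
qed

text \<open>If \<open>a \<noteq> 0\<close>, then for a small step \<open>s\<close> against the sign of \<open>a\<close> the linear term dominates
  and the expression is negative.\<close>

lemma linear_coeff_eq_0:
  fixes a b :: real
  assumes "\<And>s. \<bar>s\<bar> < 1 \<Longrightarrow> 0 \<le> s * a + s\<^sup>2 * b"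
  shows "a = 0"
proof (rule ccontr)
  assume a: "a \<noteq> 0"
  define \<epsilon> where "\<epsilon> = 1 / (1 + \<bar>a\<bar> + \<bar>b\<bar>)"
  have eps: "0 < \<epsilon>" "\<epsilon> * (1 + \<bar>a\<bar> + \<bar>b\<bar>) = 1" by (auto simp: \<epsilon>_def)
  have ab: "\<epsilon> * \<bar>a\<bar> < 1" "\<epsilon> * \<bar>b\<bar> < 1"
  proof -
    have "0 \<le> \<epsilon> * \<bar>a\<bar>" "0 \<le> \<epsilon> * \<bar>b\<bar>" using eps by simp_all
    moreover have "\<epsilon> + \<epsilon> * \<bar>a\<bar> + \<epsilon> * \<bar>b\<bar> = 1" using eps(2) by (simp add: distrib_left)
    ultimately show "\<epsilon> * \<bar>a\<bar> < 1" "\<epsilon> * \<bar>b\<bar> < 1" using eps(1) by linarith+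
  qed
  have "0 \<le> (- \<epsilon> * a) * a + (- \<epsilon> * a)\<^sup>2 * b"
    using ab eps by (intro assms) (simp add: abs_mult)
  also have "\<dots> = (\<epsilon> * a\<^sup>2) * (\<epsilon> * b - 1)" by (simp add: power2_eq_square algebra_simps)
  finally have "0 \<le> (\<epsilon> * a\<^sup>2) * (\<epsilon> * b - 1)" .
  moreover have "0 < \<epsilon> * a\<^sup>2" using eps(1) a by simp
  ultimately have "0 \<le> \<epsilon> * b - 1" by (meson mult_pos_neg not_less)
  moreover have "\<epsilon> * b \<le> \<epsilon> * \<bar>b\<bar>" using eps(1) by (intro mult_left_mono) auto
  ultimately show False using ab(2) by linarith
qed

text \<open>The summand is the current of \<open>f\<close> along the edge, since the square root of \<open>sq_diff f e\<close> is the
  potential difference. The identity is a first-order condition: raising \<open>f\<close> by \<open>s\<close> on the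
  superlevel set \<open>D\<close> changes the energy by \<open>2 s\<close> times the current through the cut, up to \<open>O(s\<^sup>2)\<close>.
  The new potential is \<open>0\<close> on \<open>A\<close> and \<open>1 + s\<close> on \<open>B\<close>, so by minimality and scaling its energy is at
  least \<open>(1 + s)\<^sup>2 m\<close>. Comparing the terms linear in \<open>s\<close>, for both signs of \<open>s\<close>, shows that the
  current is \<open>m\<close>.\<close>

lemma current_through_level_cut:
  assumes net: "electrical_network V E C" and "finite E"
    and fA: "\<forall>x\<in>A. f x = 0" and fB: "\<forall>x\<in>B. f x = 1"
    and min: "\<And>g. \<forall>x\<in>A. g x = 0 \<Longrightarrow> \<forall>x\<in>B. g x = 1 \<Longrightarrow> dirichlet E C f \<le> dirichlet E C g"
    and t: "0 < t" "t \<le> 1"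
  shows "(\<Sum>e\<in>edge_boundary E {x. t \<le> f x}. C e * sqrt (sq_diff f e)) = dirichlet E C f"
proof -
  define D where "D = {x. t \<le> f x}"
  define m where "m = dirichlet E C f"
  define F where "F = (\<Sum>e\<in>edge_boundary E D. C e * sqrt (sq_diff f e))"
  define K where "K = (\<Sum>e\<in>edge_boundary E D. C e)"
  have bd: "edge_boundary E D \<subseteq> E" by (auto simp: edge_boundary_def)
  have edge: "sq_diff (\<lambda>x. f x + s * indicator D x) e
      = sq_diff f e + (if e \<in> edge_boundary E D then 2 * s * sqrt (sq_diff f e) + s\<^sup>2 else 0)"
    if e: "e \<in> E" for e s
  proof -
    obtain x y where xy: "e = {x, y}" using e net by (auto simp: electrical_network_def)
    have "(f x + s * indicator D x - (f y + s * indicator D y))\<^sup>2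
      = (f x - f y)\<^sup>2 + (if e \<in> edge_boundary E D then 2 * s * \<bar>f x - f y\<bar> + s\<^sup>2 else 0)"
      using e unfolding xy
      by (auto simp: edge_boundary_def indicator_def D_def power2_eq_square algebra_simps)
    then show ?thesis unfolding xy by simp
  qed
  have perturbed: "dirichlet E C (\<lambda>x. f x + s * indicator D x) = m + 2 * s * F + s\<^sup>2 * K" for s
  proof -
    have "dirichlet E C (\<lambda>x. f x + s * indicator D x) =
      (\<Sum>e\<in>E. C e * sq_diff f e + (if e \<in> edge_boundary E D then C e * (2 * s * sqrt (sq_diff f e) + s\<^sup>2) else 0))"
      unfolding dirichlet_def by (intro sum.cong) (simp_all add: edge algebra_simps)
    also have "\<dots> = m + (\<Sum>e\<in>E. if e \<in> edge_boundary E D then C e * (2 * s * sqrt (sq_diff f e) + s\<^sup>2) else 0)"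
      by (simp only: sum.distrib m_def dirichlet_def)
    also have "(\<Sum>e\<in>E. if e \<in> edge_boundary E D then C e * (2 * s * sqrt (sq_diff f e) + s\<^sup>2) else 0)
        = (\<Sum>e\<in>edge_boundary E D. C e * (2 * s * sqrt (sq_diff f e) + s\<^sup>2))"
      using bd by (simp only: sum.inter_restrict[OF \<open>finite E\<close>, symmetric] Int_absorb1)
    also have "\<dots> = (\<Sum>e\<in>edge_boundary E D. 2 * s * (C e * sqrt (sq_diff f e)) + s\<^sup>2 * C e)"
      by (intro sum.cong) (simp_all add: algebra_simps)
    also have "\<dots> = 2 * s * F + s\<^sup>2 * K"
      by (simp only: F_def K_def sum_distrib_left sum.distrib)
    finally show ?thesis by simp
  qed
  have "0 \<le> s * (2 * (F - m)) + s\<^sup>2 * (K - m)" if s: "\<bar>s\<bar> < 1" for s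
  proof -
    define g where "g x = (f x + s * indicator D x) / (1 + s)" for x
    have "1 + s \<noteq> 0" using s by linarith
    then have "\<forall>x\<in>B. g x = 1" using fB t by (simp add: g_def D_def)
    moreover have "\<forall>x\<in>A. g x = 0" using fA t by (simp add: g_def D_def)
    ultimately have "m \<le> dirichlet E C g" unfolding m_def using min by blast
    also have "\<dots> = (m + 2 * s * F + s\<^sup>2 * K) / (1 + s)\<^sup>2"
      unfolding g_def dirichlet_scale[OF net] perturbed by simp
    finally have "m * (1 + s)\<^sup>2 \<le> m + 2 * s * F + s\<^sup>2 * K"
      using \<open>1 + s \<noteq> 0\<close> by (simp add: pos_le_divide_eq)
    then show ?thesis by (simp add: power2_eq_square algebra_simps)
  qed
  then have "2 * (F - m) = 0" by (rule linear_coeff_eq_0)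
  then show ?thesis by (simp add: F_def m_def D_def)
qed

lemma sum_increments_between:
  fixes ts :: "nat \<Rightarrow> real"
  assumes mono: "\<And>i j. i < j \<Longrightarrow> j \<le> n \<Longrightarrow> ts i < ts j" and ab: "a \<le> b" "b \<le> n"
  shows "(\<Sum>k<n. if ts a < ts (Suc k) \<and> ts (Suc k) \<le> ts b then ts (Suc k) - ts k else 0) = ts b - ts a"
proof -
  have less: "ts i < ts j \<longleftrightarrow> i < j" if "i \<le> n" "j \<le> n" for i j
    using mono[of i j] mono[of j i] that by (metis less_asym linorder_neqE_nat order_less_irrefl)
  have "ts a < ts (Suc k) \<and> ts (Suc k) \<le> ts b \<longleftrightarrow> k \<in> {a..<b}" if "k < n" for k
    using less[of a "Suc k"] less[of b "Suc k"] that ab by (auto simp: not_less[symmetric])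
  then have "(\<Sum>k<n. if ts a < ts (Suc k) \<and> ts (Suc k) \<le> ts b then ts (Suc k) - ts k else 0)
      = (\<Sum>k<n. if k \<in> {a..<b} then ts (Suc k) - ts k else 0)"
    by (intro sum.cong) auto
  also have "\<dots> = (\<Sum>k=a..<b. ts (Suc k) - ts k)"
  proof -
    have "{..<n} \<inter> {a..<b} = {a..<b}" using ab by auto
    then show ?thesis by (simp only: sum.inter_restrict[OF finite_lessThan, symmetric])
  qed
  also have "\<dots> = ts b - ts a" using ab by (intro sum_Suc_diff') auto
  finally show ?thesis .
qed

text \<open>For \<open>m = 0\<close> both sides are infinite. When \<open>m\<close> is the least energy, that is the case in which no path joins \<open>A\<close> to
  \<open>B\<close>, and the formula lets it be computed like all others.\<close>

lemma inverse_ennreal_quotient: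
  assumes "0 < d" "0 \<le> m"
  shows "inverse (ennreal (m / d)) = ennreal d * inverse (ennreal m)"
proof (cases "m = 0")
  case True
  with assms show ?thesis by (simp add: ennreal_mult_top)
next
  case False
  with assms show ?thesis by (simp add: inverse_ennreal ennreal_mult[symmetric] divide_inverse)
qed

section \<open>The level cuts attain the effective resistance\<close>

text \<open>The cuts are numbered by \<open>k < n\<close>, where cut \<open>k\<close> separates the values \<open>ts k\<close> and \<open>ts (Suc k)\<close>.
  An injection of the natural numbers carries this numbering to the index type.\<close>

theorem eff_resistance_attained_by_level_cuts:
  fixes V :: "'v set" and E :: "'v set set"
  assumes net: "electrical_network V E C" and "finite V"
    and AB: "A \<subseteq> V" "B \<subseteq> V" "A \<noteq> {}" "B \<noteq> {}" "A \<inter> B = {}"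
    and inf: "infinite (UNIV :: 'i set)"
  obtains I :: "'i set" and S R where "(I, S, R) \<in> allocated_cutsets V E C A B"
    "eff_resistance E C A B = (\<Sum>\<^sub>\<infinity>i\<in>I. inverse (split_conductance S R i))"
proof -
  have "E \<subseteq> Pow V" using net by (auto simp: electrical_network_def)
  with \<open>finite V\<close> have fin: "finite E" by (meson finite_Pow_iff finite_subset)
  obtain f where f: "\<forall>x\<in>A. f x = 0" "\<forall>x\<in>B. f x = 1" "\<forall>x. 0 \<le> f x \<and> f x \<le> 1"
    and min: "\<And>g. \<forall>x\<in>A. g x = 0 \<Longrightarrow> \<forall>x\<in>B. g x = 1 \<Longrightarrow> dirichlet E C f \<le> dirichlet E C g"
    using ex_minimal_potential[OF net AB(5), of thesis] by blast
  define m where "m = dirichlet E C f"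
  have m: "0 \<le> m" unfolding m_def by (rule dirichlet_nonneg[OF net])
  have "(INF g \<in> {g. (\<forall>x\<in>A. g x = 0) \<and> (\<forall>x\<in>B. g x = 1)}. energy E C g) = ennreal m"
  proof (rule INF_eqI)
    fix g :: "'v \<Rightarrow> real"
    assume "g \<in> {g. (\<forall>x\<in>A. g x = 0) \<and> (\<forall>x\<in>B. g x = 1)}"
    then show "ennreal m \<le> energy E C g"
      using min[of g] by (simp add: energy_eq_dirichlet[OF net fin] m_def ennreal_leI)
  next
    fix y assume "\<And>g :: 'v \<Rightarrow> real. g \<in> {g. (\<forall>x\<in>A. g x = 0) \<and> (\<forall>x\<in>B. g x = 1)} \<Longrightarrow> y \<le> energy E C g"
    from this[of f] show "y \<le> ennreal m"
      using f by (simp add: energy_eq_dirichlet[OF net fin] m_def)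
  qed
  then have res: "eff_resistance E C A B = inverse (ennreal m)" by (simp add: eff_resistance_def)

  define xs where "xs = sorted_list_of_set (f ` V)"
  define ts where "ts k = xs ! k" for k
  define n where "n = length xs - 1"
  have xs: "set xs = f ` V" "sorted_wrt (<) xs" 
    using \<open>finite V\<close> by (simp_all add: xs_def)
  have "xs \<noteq> []" using xs(1) AB by auto
  then have len: "length xs = Suc n" by (simp add: n_def)
  have mono: "ts i < ts j" if "i < j" "j \<le> n" for i j
    using sorted_wrt_nth_less[OF xs(2)] that by (simp add: ts_def len)
  have index: "\<exists>k\<le>n. f x = ts k" if "x \<in> V" for x
    using that xs(1) by (metis imageI in_set_conv_nth len less_Suc_eq_le ts_def)
  have range: "0 \<le> ts k" "ts k \<le> 1" if "k \<le> n" for k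
  proof -
    have "ts k \<in> f ` V" using that xs(1) len by (metis le_imp_less_Suc nth_mem ts_def)
    then show "0 \<le> ts k" "ts k \<le> 1" using f by auto
  qed
  have ts0: "ts 0 = 0"
  proof -
    obtain x where "x \<in> A" "x \<in> V" using AB by blast
    then obtain k where "k \<le> n" "ts k = 0" using index f(1) by metis
    then show ?thesis using mono[of 0 k] range[of 0] by (cases "k = 0") auto
  qed
  have tsn: "ts n = 1"
  proof -
    obtain x where "x \<in> B" "x \<in> V" using AB by blast
    then obtain k where "k \<le> n" "ts k = 1" using index f(2) by metis
    then show ?thesis using mono[of k n] range[of n] by (cases "k = n") auto
  qed

  define d where "d k = ts (Suc k) - ts k" for k
  (* Each edge gives cut k the share of its resistance that corresponds to the share d k
     of its total potential difference. *)
  define S where "S k = edge_boundary E {x. ts (Suc k) \<le> f x}" for k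
  define R where
    "R e k = (if e \<in> S k then resistance C e * d k / sqrt (sq_diff f e) else 0)" for e k
  have d: "0 < d k" if "k < n" for k using mono[of k "Suc k"] that by (simp add: d_def)
  have Cpos: "0 < C e" if "e \<in> E" for e using net that by (simp add: electrical_network_def)
  have S: "S k \<subseteq> E" for k by (auto simp: S_def edge_boundary_def)
  have sq: "0 < sq_diff f e" if "e \<in> S k" for e k
  proof -
    have eE: "e \<in> E" using that S by blast
    then obtain x y where xy: "e = {x, y}" using net by (auto simp: electrical_network_def)
    then have "f x \<noteq> f y" using that by (auto simp: S_def edge_boundary_def)
    then show ?thesis unfolding xy by simp
  qed
  have R_nonneg: "0 \<le> R e k" if "e \<in> E" "k < n" for e k
    using that d[of k] Cpos[of e] sq[of e k] by (simp add: R_def resistance_def less_imp_le)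
  have cut: "cutset V E A B (S k)" if "k < n" for k
  proof -
    have "0 < ts (Suc k)" "ts (Suc k) \<le> 1"
      using mono[of 0 "Suc k"] range[of "Suc k"] ts0 that by auto
    then have "A \<inter> {x. ts (Suc k) \<le> f x} = {}" "B \<subseteq> {x. ts (Suc k) \<le> f x}"
      using f by auto
    then show ?thesis
      unfolding cutset_iff_edge_boundary[OF net AB(1)] using S[of k] S_def[of k] by blast
  qed
  have alloc: "(\<Sum>k<n. R e k) \<le> resistance C e" if e: "e \<in> E" for e
  proof -
    obtain u v where uv: "u \<in> V" "v \<in> V" "e = {u, v}"
      using net e by (auto simp: electrical_network_def)
    obtain x y where xy: "x \<in> V" "y \<in> V" "e = {x, y}" "f x \<le> f y"
    proof (cases "f u \<le> f v")
      case True
      then show ?thesis using that[of u v] uv by simp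
    next
      case False
      then show ?thesis using that[of v u] uv by (simp add: insert_commute)
    qed
    obtain a b where ab: "a \<le> n" "b \<le> n" "f x = ts a" "f y = ts b" using index xy by metis
    have "a \<le> b" using mono[of b a] ab xy(4) by (cases "a \<le> b") auto
    have sqrt: "sqrt (sq_diff f e) = ts b - ts a"
      unfolding xy(3) sq_diff_insert using xy(4) ab by simp
    have mem: "e \<in> S k \<longleftrightarrow> ts a < ts (Suc k) \<and> ts (Suc k) \<le> ts b" for k
      using e xy(4) ab by (auto simp: S_def edge_boundary_def xy(3))
    (* When a = b the quotient below is 0 by convention and no cut contains e. *)
    have "(\<Sum>k<n. R e k) = (\<Sum>k<n. resistance C e / (ts b - ts a) *
        (if ts a < ts (Suc k) \<and> ts (Suc k) \<le> ts b then ts (Suc k) - ts k else 0))"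
      by (intro sum.cong) (simp_all add: R_def mem sqrt d_def)
    also have "\<dots> = resistance C e / (ts b - ts a) * (ts b - ts a)"
      unfolding sum_distrib_left[symmetric]
      using sum_increments_between[of n ts a b] mono \<open>a \<le> b\<close> ab by simp
    also have "\<dots> \<le> resistance C e" using Cpos[OF e] by (simp add: resistance_def)
    finally show ?thesis .
  qed
  have split: "inverse (\<Sum>\<^sub>\<infinity>e\<in>S k. inverse (ennreal (R e k))) = ennreal (d k) * inverse (ennreal m)"
    if k: "k < n" for k
  proof -
    have "finite (S k)" using S fin by (meson finite_subset)
    then have "(\<Sum>\<^sub>\<infinity>e\<in>S k. inverse (ennreal (R e k))) = (\<Sum>e\<in>S k. inverse (ennreal (R e k)))"
      by simp
    also have "\<dots> = (\<Sum>e\<in>S k. ennreal (C e * sqrt (sq_diff f e) / d k))"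
    proof (rule sum.cong)
      fix e assume e: "e \<in> S k"
      then have "0 < C e" using S Cpos by blast
      then have "0 < R e k" "inverse (R e k) = C e * sqrt (sq_diff f e) / d k"
        using e d[OF k] sq[OF e] by (simp_all add: R_def resistance_def field_simps)
      then show "inverse (ennreal (R e k)) = ennreal (C e * sqrt (sq_diff f e) / d k)"
        by (simp add: inverse_ennreal)
    qed simp
    also have "\<dots> = ennreal (\<Sum>e\<in>S k. C e * sqrt (sq_diff f e) / d k)"
    proof (rule sum_ennreal)
      fix e assume e: "e \<in> S k"
      then have "0 < C e" using S Cpos by blast
      then show "0 \<le> C e * sqrt (sq_diff f e) / d k" using d[OF k] sq[OF e] by simp
    qed
    also have "(\<Sum>e\<in>S k. C e * sqrt (sq_diff f e) / d k) = m / d k"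
    proof -
      have "0 < ts (Suc k)" "ts (Suc k) \<le> 1"
        using mono[of 0 "Suc k"] range[of "Suc k"] ts0 k by auto
      from current_through_level_cut[OF net fin f(1,2) min this]
      show ?thesis by (simp add: S_def m_def sum_divide_distrib[symmetric])
    qed
    finally show ?thesis using inverse_ennreal_quotient[OF d[OF k] m] by simp
  qed
  have total: "(\<Sum>k<n. ennreal (d k) * inverse (ennreal m)) = inverse (ennreal m)"
  proof -
    have "(\<Sum>k<n. ennreal (d k) * inverse (ennreal m)) = (\<Sum>k<n. ennreal (d k)) * inverse (ennreal m)"
      by (simp add: sum_distrib_right)
    also have "(\<Sum>k<n. ennreal (d k)) = ennreal (\<Sum>k<n. d k)"
      by (intro sum_ennreal) (simp add: d less_imp_le)
    also have "(\<Sum>k<n. d k) = 1" 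
      unfolding d_def using sum_lessThan_telescope[of ts n] ts0 tsn by simp
    finally show ?thesis by simp
  qed

  obtain \<phi> :: "nat \<Rightarrow> 'i" where \<phi>: "inj \<phi>"
    using inf unfolding infinite_iff_countable_subset by blast
  define I where "I = \<phi> ` {..<n}"
  define S' where "S' i = S (inv \<phi> i)" for i
  define R' where "R' e i = R e (inv \<phi> i)" for e i
  have reindex: "(\<Sum>\<^sub>\<infinity>i\<in>I. h i) = (\<Sum>k<n. h (\<phi> k))" for h :: "'i \<Rightarrow> ennreal"
    unfolding I_def by (subst infsum_reindex) (use \<phi> in \<open>auto simp: inj_def inj_on_def\<close>)
  have "(I, S', R') \<in> allocated_cutsets V E C A B"
    unfolding allocated_cutsets_def resistance_allocation_def
  proof (clarify, intro conjI ballI impI)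
    fix i assume "i \<in> I"
    then show "cutset V E A B (S' i)" using cut \<phi> by (auto simp: I_def S'_def)
  next
    fix e i assume "e \<in> E" "i \<in> I"
    then show "0 \<le> R' e i" using R_nonneg \<phi> by (auto simp: I_def R'_def)
  next
    fix e assume e: "e \<in> E"
    have "(\<Sum>\<^sub>\<infinity>i\<in>I. ennreal (R' e i)) = ennreal (\<Sum>k<n. R e k)"
      using R_nonneg[OF e] \<phi> by (simp add: reindex R'_def) (subst sum_ennreal, simp_all)
    then show "(\<Sum>\<^sub>\<infinity>i\<in>I. ennreal (R' e i)) \<le> ennreal (resistance C e)"
      using alloc[OF e] by (simp add: ennreal_leI)
  next
    fix e i assume "e \<notin> S' i"
    then show "R' e i = 0" by (simp add: S'_def R'_def R_def)
  qed
  moreover have "(\<Sum>\<^sub>\<infinity>i\<in>I. inverse (split_conductance S' R' i)) = inverse (ennreal m)"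
    using \<phi> split total by (simp add: reindex split_conductance_def S'_def R'_def)
  ultimately show ?thesis using that res by metis
qed

theorem proposition3p1:
  fixes V :: "'v set" and E :: "'v set set" and C :: "'v set \<Rightarrow> real" and A B :: "'v set"
  assumes "electrical_network V E C"
    and "A \<subseteq> V" and "B \<subseteq> V" and "A \<noteq> {}" and "B \<noteq> {}" and "A \<inter> B = {}"
  shows "(\<forall>(I :: 'i set) S R.
            (\<forall>i\<in>I. cutset V E A B (S i)) \<and> resistance_allocation E C I S R \<longrightarrow>
            eff_resistance E C A B \<ge> (\<Sum>\<^sub>\<infinity>i\<in>I. inverse (split_conductance S R i)))
       \<and> (finite V \<and> infinite (UNIV :: 'i set) \<longrightarrow>
            eff_resistance E C A B =
              (SUP (I :: 'i set, S, R) \<in> allocated_cutsets V E C A B.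
                 \<Sum>\<^sub>\<infinity>i\<in>I. inverse (split_conductance S R i)))"
proof -
  have lower: "(\<Sum>\<^sub>\<infinity>i\<in>I. inverse (split_conductance S R i)) \<le> eff_resistance E C A B"
    if "\<forall>i\<in>I. cutset V E A B (S i)" "resistance_allocation E C I S R" for I :: "'i set" and S R
    using sum_inverse_split_conductance_le_eff_resistance[OF assms(1,2) bspec[OF that(1)] that(2)] .
  have "eff_resistance E C A B =
      (SUP (I :: 'i set, S, R) \<in> allocated_cutsets V E C A B.
         \<Sum>\<^sub>\<infinity>i\<in>I. inverse (split_conductance S R i))"
    if fin: "finite V" and inf: "infinite (UNIV :: 'i set)"
  proof (rule antisym)
    obtain I :: "'i set" and S R where att: "(I, S, R) \<in> allocated_cutsets V E C A B"
      "eff_resistance E C A B = (\<Sum>\<^sub>\<infinity>i\<in>I. inverse (split_conductance S R i))"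
      by (rule eff_resistance_attained_by_level_cuts[OF assms(1) fin assms(2-6) inf])
    show "eff_resistance E C A B \<le> (SUP (I :: 'i set, S, R) \<in> allocated_cutsets V E C A B.
         \<Sum>\<^sub>\<infinity>i\<in>I. inverse (split_conductance S R i))"
      by (rule SUP_upper2[OF att(1)]) (simp add: att(2))
    show "(SUP (I :: 'i set, S, R) \<in> allocated_cutsets V E C A B.
         \<Sum>\<^sub>\<infinity>i\<in>I. inverse (split_conductance S R i)) \<le> eff_resistance E C A B"
      by (rule SUP_least) (use lower in \<open>auto simp: allocated_cutsets_def\<close>)
  qed
  with lower show ?thesis by blast
qed

end
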